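(* Let $q$ be a prime power, $m>3$, and $n=q^{2m}-1$. For an integer design distance $d\ge2$, the primitive narrow-sense bicyclic hyperbolic code $\mathscr{H}(n\times n,q^2;d)$ over $\mathbb{F}_{q^2}$ contains its Hermitian dual if and only if $d\le\delta_h$, where $$\delta_h=\begin{cases}(q^m-1)^2 & m\text{ odd},\\ q^{2m}-1-q^{m-1} & m\text{ even}.\end{cases}$$
   Context: Bicyclic codes over $\mathbb{F}_{q^2}$: linear subspaces of $\mathbb{F}_{q^2}^{n\times n}$ closed under cyclic shifts of rows and columns, identified with ideals of $\mathbb{F}_{q^2}[X,Y]/\langle X^n-1,Y^n-1\rangle$ via $c\mapsto\sum c_{i,j}X^iY^j$. Let $\alpha$ be a primitive $n$-th root of unity. The $q^2$-ary cyclotomic coset of $(x,y)$ is $\{(xq^{2k}\bmod n,yq^{2k}\bmod n):k\ge0\}$. $\mathscr{H}(n\times n,q^2;d)$ is the set of $c\in\mathbb{F}_{q^2}^{n\times n}$ with $c(\alpha^x,\alpha^y)=0$ for all $(x,y)$ in the union of the $q^2$-ary cyclotomic cosets of the elements of the designed set $Z_{des}=\{(x\bmod n,y\bmod n):1\le x,y\le n,\ xy<d\}$. The Hermitian dual of $C$ is $C^{\perp_h}=\{u\in\mathbb{F}_{q^2}^{n\times n}:\sum_{i,j}u_{i,j}^qc_{i,j}=0\ \forall c\in C\}$. *)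

theory Defs
  imports "HOL-Computational_Algebra.Primes"
begin

text \<open>We work inside a finite field 'b of size q^(2m) (which contains the
  primitive n-th roots of unity, n = q^(2m)-1).  The field F_(q^2) is realised
  as its unique subfield of order q^2, namely the fixed points of x -> x^(q^2).\<close>

definition prime_power :: "nat \<Rightarrow> bool" where
  "prime_power q \<longleftrightarrow> (\<exists>p k. prime p \<and> k > 0 \<and> q = p ^ k)"

definition subfield_q2 :: "nat \<Rightarrow> 'b::field set" where
  "subfield_q2 q = {x. x ^ (q^2) = x}"

definition primitive_root :: "nat \<Rightarrow> 'b::field \<Rightarrow> bool" where
  "primitive_root n a \<longleftrightarrow> a ^ n = 1 \<and> (\<forall>k. 0 < k \<and> k < n \<longrightarrow> a ^ k \<noteq> 1)"

definition words :: "nat \<Rightarrow> nat \<Rightarrow> (nat \<Rightarrow> nat \<Rightarrow> 'b::field) set" where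
  "words q n = {c. (\<forall>i j. c i j \<in> subfield_q2 q) \<and> (\<forall>i j. (n \<le> i \<or> n \<le> j) \<longrightarrow> c i j = 0)}"

definition eval2 :: "nat \<Rightarrow> (nat \<Rightarrow> nat \<Rightarrow> 'b::field) \<Rightarrow> 'b \<Rightarrow> 'b \<Rightarrow> 'b" where
  "eval2 n c a b = (\<Sum>i<n. \<Sum>j<n. c i j * a ^ i * b ^ j)"

definition design_set :: "nat \<Rightarrow> nat \<Rightarrow> (nat \<times> nat) set" where
  "design_set n d = {(x mod n, y mod n) | x y. 1 \<le> x \<and> x \<le> n \<and> 1 \<le> y \<and> y \<le> n \<and> x * y < d}"

definition cyc_coset :: "nat \<Rightarrow> nat \<Rightarrow> nat \<times> nat \<Rightarrow> (nat \<times> nat) set" where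
  "cyc_coset Q n p = {((fst p * Q ^ k) mod n, (snd p * Q ^ k) mod n) | k. True}"

definition defining_set :: "nat \<Rightarrow> nat \<Rightarrow> nat \<Rightarrow> (nat \<times> nat) set" where
  "defining_set q n d = (\<Union>p\<in>design_set n d. cyc_coset (q^2) n p)"

definition hyperbolic_code :: "nat \<Rightarrow> nat \<Rightarrow> 'b::field \<Rightarrow> nat \<Rightarrow> (nat \<Rightarrow> nat \<Rightarrow> 'b) set" where
  "hyperbolic_code q n \<alpha> d =
     {c \<in> words q n. \<forall>(x, y) \<in> defining_set q n d. eval2 n c (\<alpha> ^ x) (\<alpha> ^ y) = 0}"

definition herm_dual :: "nat \<Rightarrow> nat \<Rightarrow> (nat \<Rightarrow> nat \<Rightarrow> 'b::field) set \<Rightarrow> (nat \<Rightarrow> nat \<Rightarrow> 'b) set" where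
  "herm_dual q n C = {u \<in> words q n. \<forall>c\<in>C. (\<Sum>i<n. \<Sum>j<n. u i j ^ q * c i j) = 0}"

definition delta_h :: "nat \<Rightarrow> nat \<Rightarrow> nat" where
  "delta_h q m = (if odd m then (q^m - 1)^2 else q^(2*m) - 1 - q^(m-1))"

end

theory Submission
  imports Defs "HOL-Number_Theory.Residues" "HOL-Computational_Algebra.Polynomial"
begin

text \<open>
  Trace words \<open>Tr(\<beta> \<alpha>^(i s + j t))\<close> show that the code contains its Hermitian dual iff the defining
  set \<open>Z\<close> is disjoint from \<open>-q Z\<close> modulo \<open>n\<close>. Since \<open>Z\<close> is closed under multiplication by \<open>q^2\<close>,
  this fails iff there are \<open>x, y, x', y'\<close> in \<open>{1..n}\<close> and an odd \<open>e\<close> with \<open>x y < d\<close>, \<open>x' y' < d\<close>,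
  \<open>x' = -q^e x\<close> and \<open>y' = -q^e y\<close> modulo \<open>n\<close>; exchanging the two pairs allows to assume \<open>e \<le> m\<close>.
  Put \<open>A = q^e\<close> and \<open>B = q^(2m-e)\<close>, so that \<open>A B = n + 1\<close>. Writing \<open>x\<close> with two digits in mixed radix,
  the map \<open>x \<mapsto> x'\<close> swaps and complements the digits, and \<open>x x' \<ge> n - A\<close> except for the pairs
  \<open>(x, x') = (n - B, 1)\<close> and \<open>(B - 1, A - 1)\<close>. For \<open>e = m\<close> this gives \<open>x x' \<ge> (q^m - 1)^2\<close>, attained at
  \<open>x = y = q^m - 1\<close>. For \<open>e < m\<close>, if both \<open>x y\<close> and \<open>x' y'\<close> were below \<open>n - A\<close>, so would be
  one of \<open>x x'\<close> and \<open>y y'\<close>; that one is an exceptional pair, which makes the other pair too large.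
  The bound \<open>n - A\<close> is attained at \<open>x = 1, y = n - B\<close>.
\<close>

subsection \<open>Products of a residue with its negative multiple\<close>

text \<open>A concave quadratic in \<open>b\<close> is smallest at the ends of the interval: the
  difference of the two sides is \<open>(b - 2) * (B - b - 2)\<close>.\<close>

lemma mult_complement_ge:
  fixes b B :: int
  assumes "2 \<le> b" "b \<le> B - 2"
  shows "2 * (B - 2) \<le> b * (B - b)"
proof -
  have "0 \<le> (b - 2) * (B - b - 2)" using assms by simp
  then show ?thesis by (simp add: algebra_simps)
qed

text \<open>If both leading digits \<open>a\<close> and \<open>b'\<close> are nonzero, then
  \<open>x \<ge> B\<close> and \<open>x' \<ge> A\<close>. Otherwise one number is a single digit,
  and only its extreme values escape the quadratic bound.\<close>

lemma digit_product_cases: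
  fixes A B a a' b b' :: int
  assumes "2 \<le> A" "2 \<le> B" "0 \<le> a" "0 \<le> b" "0 \<le> a'" "0 \<le> b'"
    and sa: "a + a' = A - 1" and sb: "b + b' = B - 1"
    and x: "x = a * B + b" and x': "x' = b' * A + a'"
    and pos: "0 < x" "0 < x'"
  shows "A * B - 1 - A \<le> x * x' \<or> x = A * B - 1 - B \<and> x' = 1 \<or> x = B - 1 \<and> x' = A - 1"
proof -
  consider "a = 0" | "b' = 0" | "1 \<le> a" "1 \<le> b'" using assms by linarith
  then show ?thesis
  proof cases
    case 1
    then have a': "a' = A - 1" and b': "b' = B - 1 - b" using sa sb by auto
    have xb: "x = b" and xb': "x' = (B - b) * A - 1"
      using x x' unfolding 1 a' b' by (simp_all add: algebra_simps)
    consider "b = 1" | "b = B - 1" | "2 \<le> b" "b \<le> B - 2"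
      using xb pos b' assms by linarith
    then show ?thesis
    proof cases
      case 3
      have "A * (2 * (B - 2)) \<le> A * (b * (B - b))"
        using mult_complement_ge[OF 3] assms(1) by (intro mult_left_mono) auto
      \<comment> \<open>This is the amount by which \<open>2 * A * (B - 2) - (B - 2)\<close> exceeds
        \<open>A * B - 1 - A\<close>.\<close>
      moreover have "0 \<le> (A - 1) * (B - 3)" using 3 assms by simp
      moreover have "x * x' = A * (b * (B - b)) - b"
        unfolding xb xb' by (simp add: algebra_simps)
      ultimately show ?thesis using 3 by (simp add: algebra_simps)
    next
      case 1
      then show ?thesis unfolding xb xb' by (simp add: algebra_simps)
    next
      case 2
      then show ?thesis unfolding xb xb' by simp
    qed
  next
    case 2
    then have b: "b = B - 1" and a: "a = A - 1 - a'" using sa sb by auto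
    have xa: "x = (A - a') * B - 1" and xa': "x' = a'"
      using x x' unfolding 2 a b by (simp_all add: algebra_simps)
    consider "a' = 1" | "a' = A - 1" | "2 \<le> a'" "a' \<le> A - 2"
      using xa' pos a assms by linarith
    then show ?thesis
    proof cases
      case 3
      have "B * (2 * (A - 2)) \<le> B * (a' * (A - a'))"
        using mult_complement_ge[OF 3] assms(2) by (intro mult_left_mono) auto
      moreover have "0 \<le> B * (A - 4)" using 3 assms by simp
      moreover have "x * x' = B * (a' * (A - a')) - a'"
        unfolding xa xa' by (simp add: algebra_simps)
      ultimately show ?thesis using 3 by (simp add: algebra_simps)
    next
      case 1
      then show ?thesis unfolding xa xa' by (simp add: algebra_simps)
    next
      case 2
      then show ?thesis unfolding xa xa' by simp
    qed
  next
    case 3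
    have "1 * B \<le> a * B" "1 * A \<le> b' * A"
      using 3 assms(1,2) by (intro mult_right_mono; simp)+
    then have "B \<le> x" "A \<le> x'" using x x' assms(4,5) by linarith+
    then have "B * A \<le> x * x'" using assms(1,2) by (intro mult_mono) auto
    then show ?thesis using assms(1) by (simp add: algebra_simps)
  qed
qed

text \<open>As \<open>A * B\<close> is 1 modulo \<open>n\<close>, multiplication by \<open>A\<close>
  turns \<open>a * B + b\<close> into \<open>b * A + a\<close>; as
  \<open>n = (B - 1) * A + (A - 1)\<close>, negation complements each digit. The bound
  \<open>x < n\<close> is strict because complementing the digits of \<open>n\<close> gives 0,
  whereas \<open>x'\<close> would be \<open>n\<close>.\<close>

lemma neg_mult_digits:
  fixes A B n x x' :: int
  assumes AB: "A * B = n + 1" "2 \<le> A" "2 \<le> B"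
    and x: "0 < x" "x < n" and x': "0 < x'" "x' \<le> n"
    and dv: "n dvd A * x + x'"
  obtains a a' b b' where "0 \<le> a" "0 \<le> b" "0 \<le> a'" "0 \<le> b'" "a + a' = A - 1" "b + b' = B - 1"
    "x = a * B + b" "x' = b' * A + a'"
proof -
  define a b where "a = x div B" and "b = x mod B"
  have xe: "x = a * B + b" by (simp add: a_def b_def)
  have b: "0 \<le> b" "b \<le> B - 1" using AB by (auto simp: b_def)
  have a0: "0 \<le> a" using x AB by (simp add: a_def pos_imp_zdiv_nonneg_iff)
  have "a * B < A * B" using xe b x AB by linarith
  then have "a < A" using AB mult_less_cancel_right_pos[of B a A] by linarith
  then have a1: "a \<le> A - 1" by simp
  have "A * x + x' = a * (A * B) + (b * A + a + x') - a" by (simp add: xe algebra_simps)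
  then have "A * x + x' = a * n + (b * A + a + x')" by (simp add: AB algebra_simps)
  then have "n dvd b * A + a + x'" using dv by (metis dvd_add_right_iff dvd_triv_right)
  then obtain k where k: "b * A + a + x' = n * k" by (auto simp: dvd_def)
  have n: "0 < n" using x by simp
  have bA: "b * A \<le> (B - 1) * A" "0 \<le> b * A" using b AB by (auto intro: mult_right_mono)
  have BA: "(B - 1) * A = n + 1 - A" using AB by (simp add: algebra_simps)
  have "0 < n * k" using k bA a0 x' by linarith
  then have "1 \<le> k" using n by (simp add: zero_less_mult_iff)
  \<comment> \<open>Only \<open>x = n\<close> has both digits maximal. The strict bound leaves
    \<open>k = 1\<close> as the only multiple.\<close>
  have "b * A + a < n"
  proof (rule ccontr)
    assume "\<not> ?thesis"
    then have "a = A - 1" "b * A = (B - 1) * A" using bA BA a1 by linarith+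
    moreover from this have "b = B - 1" using AB by simp
    ultimately have "x = (A - 1) * B + (B - 1)" using xe by blast
    then have "x = A * B - 1" by (simp add: algebra_simps)
    then have "x = n" using AB by simp
    then show False using x by simp
  qed
  then have "n * k < n * 2" using k x' by linarith
  then have "k = 1" using n \<open>1 \<le> k\<close> by simp
  then have "x' = (B - 1 - b) * A + (A - 1 - a)" using k AB by (simp add: algebra_simps)
  then show thesis using that[of a b "A - 1 - a" "B - 1 - b"] a0 a1 b xe by simp
qed

lemma neg_mult_product_cases:
  fixes A B n x x' :: int
  assumes "A * B = n + 1" "2 \<le> A" "2 \<le> B"
    and "0 < x" "x \<le> n" and "0 < x'" "x' \<le> n" and "n dvd A * x + x'"
  shows "n - A \<le> x * x' \<or> x = n - B \<and> x' = 1 \<or> x = B - 1 \<and> x' = A - 1"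
proof (cases "x = n")
  case True
  have "n * 1 \<le> x * x'" using assms True by (intro mult_mono) auto
  then show ?thesis using assms by simp
next
  case False
  then have "x < n" using assms by simp
  then obtain a a' b b' where *: "0 \<le> a" "0 \<le> b" "0 \<le> a'" "0 \<le> b'" "a + a' = A - 1" "b + b' = B - 1"
    "x = a * B + b" "x' = b' * A + a'"
    using neg_mult_digits[OF assms(1-4) _ assms(6-8)] by metis
  show ?thesis
    using digit_product_cases[OF assms(2,3) * assms(4,6)] assms(1) by simp
qed

text \<open>The left side equals \<open>n - A - (B - 2)\<close> and \<open>n - B - (A - 2)\<close>,
  so it is at most the product in the first two alternatives; the third attains it.\<close>

lemma neg_mult_product_bound:
  fixes A B n x x' :: int
  assumes "A * B = n + 1" "2 \<le> A" "2 \<le> B"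
    and "0 < x" "x \<le> n" and "0 < x'" "x' \<le> n" and "n dvd A * x + x'"
  shows "(A - 1) * (B - 1) \<le> x * x'"
  using neg_mult_product_cases[OF assms] assms(1-3)
  by (auto simp: algebra_simps)

text \<open>The products \<open>(x * y) * (x' * y')\<close> and \<open>(x * x') * (y * y')\<close>
  agree, so two small factors on one side force a small factor on the other, hence an exceptional
  pair.\<close>

lemma neg_mult_pair_bound:
  fixes A B n x x' y y' :: int
  assumes AB: "A * B = n + 1" "2 \<le> A" "4 * A \<le> B"
    and x: "0 < x" "x \<le> n" "0 < x'" "x' \<le> n" "n dvd A * x + x'"
    and y: "0 < y" "y \<le> n" "0 < y'" "y' \<le> n" "n dvd A * y + y'"
  shows "n - A \<le> x * y \<or> n - A \<le> x' * y'"
proof (rule ccontr)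
  assume "\<not> ?thesis"
  then have lt: "x * y < n - A" "x' * y' < n - A" by auto
  \<comment> \<open>The case of small \<open>x * x'\<close>; the other one follows by exchanging
    \<open>(x, x')\<close> with \<open>(y, y')\<close>.\<close>
  have main: False
    if lt: "x * y < n - A" "x' * y' < n - A" and small: "x * x' < n - A"
      and x: "0 < x" "x \<le> n" "0 < x'" "x' \<le> n" "n dvd A * x + x'"
      and y: "0 < y" "y \<le> n" "0 < y'" "y' \<le> n" "n dvd A * y + y'"
    for x x' y y' :: int
  proof -
    have n2: "2 * B \<le> n + 1" using AB mult_right_mono[of 2 A B] by simp
    have B2: "2 \<le> B" using AB by simp
    \<comment> \<open>Below \<open>B\<close> the leading digit of \<open>y\<close> is zero, which
      determines both digits of \<open>y'\<close>.\<close>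
    have yB: "y' = n - A * y" if "y < B"
    proof -
      have "y < n" using that n2 AB by linarith
      then obtain a a' b b' where *: "0 \<le> a" "0 \<le> b" "0 \<le> a'" "0 \<le> b'"
        "a + a' = A - 1" "b + b' = B - 1" "y = a * B + b" "y' = b' * A + a'"
        using neg_mult_digits[OF AB(1,2) B2 y(1) _ y(3-5)] by metis
      have "a * B < 1 * B" using *(2,7) that by linarith
      then have "a = 0" using *(1) B2 mult_less_cancel_right_pos[of B a 1] by linarith
      then have "a' = A - 1" "b' = B - 1 - y" using *(5-7) by auto
      then have "y' = (B - 1 - y) * A + (A - 1)" using *(8) by blast
      then show ?thesis using AB by (simp add: algebra_simps)
    qed
    from neg_mult_product_cases[OF AB(1,2) B2 x] small
    consider "x = n - B" "x' = 1" | "x = B - 1" "x' = A - 1" by linarith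
    then show False
    proof cases
      case 1
      \<comment> \<open>From \<open>y \<ge> 2\<close> would follow
        \<open>x * y \<ge> 2 * (n - B) \<ge> n - 1\<close>. The remaining \<open>y = 1\<close> gives
        \<open>x' * y' = n - A\<close>.\<close>
      have "y < 2"
      proof (rule ccontr)
        assume "\<not> ?thesis"
        then have "x * 2 \<le> x * y" using x by simp
        then show False using lt 1 n2 AB by linarith
      qed
      then have "y = 1" using y by simp
      then show False using yB lt 1 B2 by simp
    next
      case 2
      have "y < A"
      proof (rule ccontr)
        assume "\<not> ?thesis"
        then have "(B - 1) * A \<le> x * y" using 2 B2 by simp
        then show False using lt AB by (simp add: algebra_simps)
      qed
      then have y': "y' = n - A * y" using yB AB by simp
      \<comment> \<open>Here \<open>4 * A \<le> B\<close> enters: \<open>A * y\<close> is at most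
        half of \<open>n\<close>, so \<open>y'\<close> is at least half of \<open>n\<close>, and a
        factor \<open>x' = A - 1\<close> of at least 2 makes \<open>x' * y'\<close> too large. For
        \<open>A = 2\<close> both \<open>y\<close> and \<open>x'\<close> are 1, and
        \<open>x' * y'\<close> is exactly \<open>n - A\<close>.\<close>
      have "A * y \<le> A * A" using \<open>y < A\<close> AB(2) by (intro mult_left_mono) auto
      moreover have "A * (4 * A) \<le> A * B" using AB(2,3) by (intro mult_left_mono) auto
      then have "4 * (A * A) \<le> A * B" by simp
      moreover have "2 * A \<le> A * A" using AB(2) by simp
      ultimately have ny: "n \<le> 2 * (n - A * y)" using AB(1,2) by (smt (verit))
      show False
      proof (cases "A = 2")
        case True
        then show False using \<open>y < A\<close> y y' lt 2 by simp
      next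
        case False
        have "2 * y' \<le> (A - 1) * y'" using False AB y by (intro mult_right_mono) auto
        then show False using ny lt(2) 2(2) y' AB(2) by simp
      qed
    qed
  qed
  show False
  proof (cases "x * x' < n - A")
    case True
    then show False using main lt x y by blast
  next
    case False
    have nA: "0 < n - A" using lt(1) mult_pos_pos[OF x(1) y(1)] by linarith
    have "y * y' < n - A"
    proof (rule ccontr)
      assume "\<not> ?thesis"
      then have "(n - A) * (n - A) \<le> (x * x') * (y * y')"
        using False nA x y by (intro mult_mono) auto
      moreover have "(x * y) * (x' * y') < (n - A) * (n - A)"
        using lt nA x y by (intro mult_strict_mono) auto
      ultimately show False by (simp add: algebra_simps)
    qed
    then show False using main[of y x y' x'] lt x y by (simp add: mult.commute)
  qed
qed

subsection \<open>Conflicts in the defining set\<close>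

lemma dvd_mult_mod_add_mod: "n dvd a * (x mod n) + y mod n \<longleftrightarrow> n dvd a * x + (y :: nat)"
proof -
  have "[a * (x mod n) + y mod n = a * x + y] (mod n)"
    by (intro cong_add cong_mult cong_refl) (simp_all add: cong_def)
  then show ?thesis by (rule cong_dvd_iff)
qed

lemma dvd_power_mult_add_cong:
  fixes q n x y :: nat
  assumes "[q ^ i = q ^ j] (mod n)"
  shows "n dvd q ^ i * x + y \<longleftrightarrow> n dvd q ^ j * x + y"
proof -
  have "[q ^ i * x + y = q ^ j * x + y] (mod n)"
    using assms by (intro cong_add cong_mult cong_refl)
  then show ?thesis by (rule cong_dvd_iff)
qed

lemma power_period_cong:
  fixes q r n :: nat
  assumes "n = q ^ r - 1" "0 < q"
  shows "[q ^ (r * t + i) = q ^ i] (mod n)"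
proof -
  have "q ^ r = n + 1" using assms by simp
  then have "[q ^ r = 1] (mod n)" by (simp add: cong_def del: add_Suc_right One_nat_def)
  then have "[(q ^ r) ^ t * q ^ i = 1 ^ t * q ^ i] (mod n)"
    by (intro cong_mult cong_pow cong_refl)
  then show ?thesis by (simp add: power_add power_mult)
qed

text \<open>The even coset shifts of the two points and the factor \<open>q\<close> combine into one
  odd power of \<open>q\<close>, whose exponent matters only modulo \<open>2 * m\<close>.
  Representatives come from \<open>{1..n}\<close>, so that residue 0 counts as \<open>n\<close> in
  the products.\<close>

lemma defining_set_conflict_iff:
  fixes q m n d :: nat
  assumes q: "0 < q" and m: "0 < m" and n: "n = q ^ (2 * m) - 1"
  shows "(\<exists>(x, y) \<in> defining_set q n d. \<exists>(x', y') \<in> defining_set q n d.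
            n dvd q * x + x' \<and> n dvd q * y + y') \<longleftrightarrow>
         (\<exists>e x y x' y'. odd e \<and> e < 2 * m \<and> x \<in> {1..n} \<and> y \<in> {1..n} \<and> x' \<in> {1..n} \<and> y' \<in> {1..n} \<and>
            x * y < d \<and> x' * y' < d \<and> n dvd q ^ e * x + x' \<and> n dvd q ^ e * y + y')"
    (is "?L \<longleftrightarrow> ?R")
proof
  assume ?L
  then obtain x0 y0 x0' y0' where Z: "(x0, y0) \<in> defining_set q n d" "(x0', y0') \<in> defining_set q n d"
    and dv: "n dvd q * x0 + x0'" "n dvd q * y0 + y0'" by blast
  from Z(1) obtain x y k where x: "x \<in> {1..n}" "y \<in> {1..n}" "x * y < d"
    and x0: "x0 = (x mod n * (q\<^sup>2) ^ k) mod n" "y0 = (y mod n * (q\<^sup>2) ^ k) mod n"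
    by (auto simp: defining_set_def design_set_def cyc_coset_def)
  from Z(2) obtain x' y' l where x': "x' \<in> {1..n}" "y' \<in> {1..n}" "x' * y' < d"
    and x0': "x0' = (x' mod n * (q\<^sup>2) ^ l) mod n" "y0' = (y' mod n * (q\<^sup>2) ^ l) mod n"
    by (auto simp: defining_set_def design_set_def cyc_coset_def)
  \<comment> \<open>Multiplying by \<open>q ^ (2 * (m - 1) * l)\<close> turns the shift
    \<open>q ^ (2 * l)\<close> of the second point into \<open>q ^ (2 * m * l)\<close>, which is 1
    modulo \<open>n\<close>; \<open>E\<close> is the exponent then left at the first point.\<close>
  define E where "E = 2 * (m - 1) * l + 2 * k + 1"
  have odd: "odd (E mod (2 * m))" by (simp add: E_def dvd_mod_iff)
  have reduce: "n dvd q ^ (E mod (2 * m)) * z + z'"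
    if "n dvd q * ((z mod n * (q\<^sup>2) ^ k) mod n) + (z' mod n * (q\<^sup>2) ^ l) mod n" for z z'
  proof -
    have "n dvd q * (z * (q\<^sup>2) ^ k) + z' * (q\<^sup>2) ^ l"
      using that unfolding mod_mult_left_eq dvd_mult_mod_add_mod .
    then have "n dvd q ^ (2 * (m - 1) * l) * (q * (z * (q\<^sup>2) ^ k) + z' * (q\<^sup>2) ^ l)"
      by (rule dvd_mult)
    also have "\<dots> = q ^ (2 * (m - 1) * l + 2 * l) * z' + q ^ E * z"
      by (simp add: E_def power_add power_mult[symmetric] algebra_simps)
    also have "2 * (m - 1) * l + 2 * l = 2 * m * l + 0" using m by (cases m) (auto simp: algebra_simps)
    finally have "n dvd q ^ 0 * z' + q ^ E * z"
      using dvd_power_mult_add_cong[OF power_period_cong[OF n q]] by blast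
    then have "n dvd q ^ E * z + z'" by (simp add: add.commute)
    moreover have "[q ^ E = q ^ (E mod (2 * m))] (mod n)"
      using power_period_cong[OF n q, of "E div (2 * m)" "E mod (2 * m)"] by simp
    ultimately show ?thesis using dvd_power_mult_add_cong by blast
  qed
  have "E mod (2 * m) < 2 * m" using m by simp
  moreover have "n dvd q ^ (E mod (2 * m)) * x + x'" "n dvd q ^ (E mod (2 * m)) * y + y'"
    using reduce dv unfolding x0 x0' by blast+
  ultimately show ?R using odd x x' by blast
next
  assume ?R
  then obtain e x y x' y' where "odd e" and x: "x \<in> {1..n}" "y \<in> {1..n}" "x' \<in> {1..n}" "y' \<in> {1..n}"
    "x * y < d" "x' * y' < d" and dv: "n dvd q ^ e * x + x'" "n dvd q ^ e * y + y'" by blast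
  from \<open>odd e\<close> obtain k where e: "e = 2 * k + 1" by (elim oddE)
  \<comment> \<open>The even part of \<open>e\<close> becomes the shift of the first point; the
    second point is not shifted.\<close>
  let ?f = "\<lambda>z. (z mod n * (q\<^sup>2) ^ k) mod n" and ?g = "\<lambda>z. (z mod n * (q\<^sup>2) ^ 0) mod n"
  have "(x mod n, y mod n) \<in> design_set n d" "(x' mod n, y' mod n) \<in> design_set n d"
    using x unfolding design_set_def by auto
  then have "(?f x, ?f y) \<in> defining_set q n d" "(?g x', ?g y') \<in> defining_set q n d"
    unfolding defining_set_def cyc_coset_def by (force simp del: power_0)+
  moreover have "n dvd q * ?f z + ?g z'" if "n dvd q ^ e * z + z'" for z z'
  proof -
    have "q ^ e * z + z' = q * (z * (q\<^sup>2) ^ k) + z'"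
      by (simp add: e algebra_simps flip: power_mult)
    then show ?thesis using that
      unfolding mod_mult_left_eq dvd_mult_mod_add_mod by (simp only: power_0 mult_1_right)
  qed
  ultimately show ?L using dv by blast
qed

lemma defining_set_mult:
  assumes "(x, y) \<in> defining_set q n d"
  shows "((x * q ^ (2 * k)) mod n, (y * q ^ (2 * k)) mod n) \<in> defining_set q n d"
proof -
  from assms obtain p l where p: "p \<in> design_set n d"
    and xy: "x = (fst p * (q\<^sup>2) ^ l) mod n" "y = (snd p * (q\<^sup>2) ^ l) mod n"
    by (auto simp: defining_set_def cyc_coset_def)
  have "(x * q ^ (2 * k)) mod n = (fst p * (q\<^sup>2) ^ (l + k)) mod n"
       "(y * q ^ (2 * k)) mod n = (snd p * (q\<^sup>2) ^ (l + k)) mod n"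
    by (simp_all add: xy mod_simps power_add power_mult mult.assoc)
  then show ?thesis using p unfolding defining_set_def cyc_coset_def by blast
qed

lemma defining_set_less:
  assumes "(x, y) \<in> defining_set q n d" "0 < n"
  shows "x < n" "y < n"
  using assms by (auto simp: defining_set_def cyc_coset_def)

subsection \<open>Duality and trace words\<close>

locale bicyclic =
  fixes q m n :: nat and \<alpha> :: "'b::{finite,field}"
  assumes prime_power: "prime_power q"
    and card_UNIV: "card (UNIV :: 'b set) = q ^ (2 * m)"
    and m_pos: "0 < m"
    and n_eq: "n = q ^ (2 * m) - 1"
    and primitive: "primitive_root n \<alpha>"
begin

section \<open>Arithmetic of the field and its primitive root\<close>

lemma q_ge_2: "2 \<le> q"
proof -
  obtain p k where p: "prime p" "0 < k" "q = p ^ k" using prime_power by (auto simp: prime_power_def)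
  have "2 \<le> p" using p prime_ge_2_nat by blast
  also have "p \<le> p ^ k" using p \<open>2 \<le> p\<close> by (intro self_le_power) auto
  finally show ?thesis using p by simp
qed

lemma n_pos: "0 < n"
  using q_ge_2 m_pos one_less_power[of q "2 * m"] by (simp add: n_eq)

lemma Suc_n: "Suc n = q ^ (2 * m)"
  using n_pos by (simp add: n_eq)

text \<open>Needed for additivity of the \<open>q\<close>-th power. The characteristic divides the
  order of the field, a power of \<open>p\<close>.\<close>

lemma q_eq_CHAR_power: "\<exists>k. q = CHAR('b) ^ k"
proof -
  obtain p k where p: "prime p" "q = p ^ k" using prime_power by (auto simp: prime_power_def)
  have "prime CHAR('b)" by (intro prime_CHAR_semidom finite_imp_CHAR_pos) simp
  moreover have "CHAR('b) dvd (p ^ k) ^ (2 * m)"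
    using CHAR_dvd_CARD[where ?'a = 'b] card_UNIV p by simp
  ultimately have "CHAR('b) = p"
    using p by (meson prime_dvd_power primes_dvd_imp_eq)
  then show ?thesis using p by blast
qed

lemma sum_power_q_power: "(\<Sum>i\<in>S. f i) ^ (q ^ j) = (\<Sum>i\<in>S. (f i :: 'b) ^ (q ^ j))"
proof -
  obtain k where k: "q = CHAR('b) ^ k" using q_eq_CHAR_power by blast
  show ?thesis
    by (rule freshmans_dream_sum'[of _ "k * j"])
       (auto simp: k power_mult intro!: prime_CHAR_semidom finite_imp_CHAR_pos)
qed

lemma sum_power_q: "(\<Sum>i\<in>S. f i) ^ q = (\<Sum>i\<in>S. (f i :: 'b) ^ q)"
  using sum_power_q_power[of f S 1] by simp

lemma of_nat_n: "of_nat n = (-1 :: 'b)"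
proof -
  have "of_nat (Suc n) = (0 :: 'b)"
    using CHAR_dvd_CARD[where ?'a = 'b] card_UNIV Suc_n by (simp only: of_nat_eq_0_iff_char_dvd)
  then show ?thesis by (simp add: add_eq_0_iff)
qed

lemma power_n: "\<alpha> ^ n = 1"
  using primitive by (simp add: primitive_root_def)

lemma alpha_nonzero: "\<alpha> \<noteq> 0"
  using power_n n_pos by (auto simp: power_0_left)

lemma power_mod_n: "\<alpha> ^ (k mod n) = \<alpha> ^ k"
proof -
  have "\<alpha> ^ k = \<alpha> ^ (n * (k div n) + k mod n)" by simp
  also have "\<dots> = \<alpha> ^ (k mod n)" by (simp only: power_add power_mult power_n) simp
  finally show ?thesis by simp
qed

lemma power_eq_1_iff: "\<alpha> ^ k = 1 \<longleftrightarrow> n dvd k"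
proof -
  have "\<alpha> ^ (k mod n) = 1 \<longleftrightarrow> k mod n = 0"
    using primitive n_pos by (metis mod_less_divisor neq0_conv power_0 primitive_root_def)
  then show ?thesis by (simp add: power_mod_n dvd_eq_mod_eq_0)
qed

text \<open>The \<open>n\<close> distinct powers of \<alpha> exhaust the nonzero elements, so all of
  these are \<open>n\<close>-th roots of unity.\<close>

lemma power_card_UNIV: "(z :: 'b) ^ (q ^ (2 * m)) = z"
proof (cases "z = 0")
  case False
  have "inj_on (\<lambda>i. \<alpha> ^ i) {..<n}"
  proof (rule linorder_inj_onI)
    fix i j assume "i < j" "i \<in> {..<n}" "j \<in> {..<n}"
    then have "\<alpha> ^ (j - i) \<noteq> 1" using power_eq_1_iff[of "j - i"] by (auto dest: dvd_imp_le)
    moreover have "\<alpha> ^ j = \<alpha> ^ i * \<alpha> ^ (j - i)" using \<open>i < j\<close> by (simp flip: power_add)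
    ultimately show "\<alpha> ^ i \<noteq> \<alpha> ^ j" using alpha_nonzero by simp
  qed auto
  then have "card ((\<lambda>i. \<alpha> ^ i) ` {..<n}) = card (UNIV - {0 :: 'b})"
    using card_UNIV Suc_n by (simp add: card_image card_Diff_singleton)
  then have "(\<lambda>i. \<alpha> ^ i) ` {..<n} = UNIV - {0}"
    using alpha_nonzero by (intro card_subset_eq) auto
  then obtain i where "z = \<alpha> ^ i" using False by blast
  then have "z ^ n = 1" using power_n by (metis mult.commute power_mult power_one)
  then show ?thesis by (simp flip: Suc_n)
qed (use q_ge_2 in \<open>simp add: power_0_left\<close>)

lemma sum_powers: "(\<Sum>i<n. (\<alpha> ^ k) ^ i) = (if n dvd k then -1 else 0)"
proof (cases "n dvd k")
  case True
  then have "\<alpha> ^ k = 1" by (simp add: power_eq_1_iff)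
  then show ?thesis using True of_nat_n by simp
next
  case False
  have "(\<alpha> ^ k - 1) * (\<Sum>i<n. (\<alpha> ^ k) ^ i) = (\<alpha> ^ k) ^ n - 1"
    by (simp add: power_diff_1_eq)
  also have "\<dots> = 0" using power_n by (metis mult.commute power_mult power_one diff_self)
  finally show ?thesis using False power_eq_1_iff by simp
qed

text \<open>A polynomial of degree below \<open>q ^ (2 * m)\<close> cannot vanish on the whole field
  unless it is zero; \<open>0 \<in> S\<close> supplies the linear coefficient 1. For
  \<open>S = {..<m}\<close> this says that the trace is not identically zero.\<close>

lemma linearized_nonzero:
  assumes S: "S \<subseteq> {..<m}" "0 \<in> S"
  shows "\<exists>z :: 'b. (\<Sum>l\<in>S. z ^ (q ^ (2 * l))) \<noteq> 0"
proof (rule ccontr)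
  assume "\<not> ?thesis"
  then have zero: "(\<Sum>l\<in>S. z ^ (q ^ (2 * l))) = 0" for z :: 'b by blast
  define P :: "'b poly" where "P = (\<Sum>l\<in>S. monom 1 (q ^ (2 * l)))"
  have "finite S" using S finite_subset by blast
  have "coeff P 1 = (\<Sum>l\<in>S. if l = 0 then 1 else 0)"
    unfolding P_def coeff_sum using q_ge_2
    by (intro sum.cong) auto
  also have "\<dots> = 1" using \<open>finite S\<close> S by simp
  finally have "P \<noteq> 0" by auto
  have "degree P \<le> q ^ (2 * (m - 1))"
    unfolding P_def using \<open>finite S\<close>
  proof (rule degree_sum_le)
    fix l assume "l \<in> S"
    then have "l \<le> m - 1" using S by auto
    then have "q ^ (2 * l) \<le> q ^ (2 * (m - 1))" using q_ge_2 by (intro power_increasing) auto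
    then show "degree (monom (1 :: 'b) (q ^ (2 * l))) \<le> q ^ (2 * (m - 1))"
      using degree_monom_le le_trans by blast
  qed
  also have "\<dots> < q ^ (2 * m)" using q_ge_2 m_pos by (intro power_strict_increasing) auto
  also have "\<dots> = card {z. poly P z = 0}"
    using zero by (simp add: card_UNIV P_def poly_sum poly_monom)
  also have "\<dots> \<le> degree P" using card_poly_roots_bound[OF \<open>P \<noteq> 0\<close>] .
  finally show False by simp
qed

section \<open>Trace words, their evaluations and Hermitian products\<close>

text \<open>The sum is the trace to the subfield of order \<open>q\<^sup>2\<close>; the zero padding
  is what \<open>words\<close> demands.\<close>

definition trace_word :: "'b \<Rightarrow> nat \<Rightarrow> nat \<Rightarrow> nat \<Rightarrow> nat \<Rightarrow> 'b" where
  "trace_word \<beta> s t i j =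
     (if i < n \<and> j < n then \<Sum>l<m. (\<beta> * \<alpha> ^ (i * s + j * t)) ^ (q ^ (2 * l)) else 0)"

text \<open>The \<open>q\<^sup>2\<close>-th power shifts the conjugates by one place, and the last
  returns to the first.\<close>

lemma trace_word_in_words: "trace_word \<beta> s t \<in> words q n"
proof -
  have "(\<Sum>l<m. z ^ (q ^ (2 * l))) ^ q\<^sup>2 = (\<Sum>l<m. z ^ (q ^ (2 * l)))" for z :: 'b
  proof -
    have "(\<Sum>l<m. z ^ (q ^ (2 * l))) ^ q\<^sup>2 = (\<Sum>l<m. z ^ (q ^ (2 * Suc l)))"
      unfolding sum_power_q_power by (simp add: power_add power2_eq_square algebra_simps flip: power_mult)
    also have "z + \<dots> = (\<Sum>l<Suc m. z ^ (q ^ (2 * l)))"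
      by (subst sum.lessThan_Suc_shift) simp
    also have "\<dots> = z + (\<Sum>l<m. z ^ (q ^ (2 * l)))" by (simp add: power_card_UNIV)
    finally show ?thesis by simp
  qed
  moreover have "(0 :: 'b) ^ q\<^sup>2 = 0" using q_ge_2 by simp
  ultimately show ?thesis by (auto simp: words_def subfield_q2_def trace_word_def)
qed

text \<open>For each conjugate the double sum factors into two geometric sums, each -1 or 0; the
  signs cancel.\<close>

lemma eval2_trace_word:
  "eval2 n (trace_word \<beta> s t) (\<alpha> ^ x) (\<alpha> ^ y) =
   (\<Sum>l | l < m \<and> n dvd s * q ^ (2 * l) + x \<and> n dvd t * q ^ (2 * l) + y. \<beta> ^ (q ^ (2 * l)))"
proof -
  let ?A = "\<lambda>l. s * q ^ (2 * l) + x" and ?B = "\<lambda>l. t * q ^ (2 * l) + y"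
  have "eval2 n (trace_word \<beta> s t) (\<alpha> ^ x) (\<alpha> ^ y) =
    (\<Sum>i<n. \<Sum>j<n. \<Sum>l<m. \<beta> ^ (q ^ (2 * l)) * ((\<alpha> ^ ?A l) ^ i * (\<alpha> ^ ?B l) ^ j))"
    unfolding eval2_def trace_word_def
    by (intro sum.cong refl)
       (simp add: sum_distrib_left sum_distrib_right power_mult_distrib power_add algebra_simps
         flip: power_mult)
  also have "\<dots> = (\<Sum>i<n. \<Sum>l<m. \<Sum>j<n. \<beta> ^ (q ^ (2 * l)) * ((\<alpha> ^ ?A l) ^ i * (\<alpha> ^ ?B l) ^ j))"
    by (rule sum.cong[OF refl]) (rule sum.swap)
  also have "\<dots> = (\<Sum>l<m. \<Sum>i<n. \<Sum>j<n. \<beta> ^ (q ^ (2 * l)) * ((\<alpha> ^ ?A l) ^ i * (\<alpha> ^ ?B l) ^ j))"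
    by (rule sum.swap)
  also have "\<dots> = (\<Sum>l<m. \<beta> ^ (q ^ (2 * l)) * ((\<Sum>i<n. (\<alpha> ^ ?A l) ^ i) * (\<Sum>j<n. (\<alpha> ^ ?B l) ^ j)))"
    unfolding sum_product by (simp only: sum_distrib_left)
  also have "\<dots> = (\<Sum>l<m. if n dvd ?A l \<and> n dvd ?B l then \<beta> ^ (q ^ (2 * l)) else 0)"
    unfolding sum_powers by (intro sum.cong refl) simp
  also have "\<dots> = (\<Sum>l | l < m \<and> n dvd ?A l \<and> n dvd ?B l. \<beta> ^ (q ^ (2 * l)))"
    by (subst sum.inter_filter[symmetric]) (auto intro!: sum.cong)
  finally show ?thesis .
qed

lemma words_power: "c \<in> words q n \<Longrightarrow> c i j ^ (q ^ (2 * l)) = c i j"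
proof (induction l)
  case (Suc l)
  have "c i j ^ (q ^ (2 * Suc l)) = (c i j ^ (q ^ (2 * l))) ^ q\<^sup>2"
    by (simp add: power_mult[symmetric] power_add algebra_simps power2_eq_square)
  also have "\<dots> = c i j" using Suc by (simp add: words_def subfield_q2_def)
  finally show ?case .
qed simp

text \<open>The \<open>q\<close>-th powers of the entries of \<open>u\<close> are fixed by the
  \<open>q\<^sup>2\<close>-power map and move inside the trace; the frequencies \<open>q * x\<close>
  and \<open>q * y\<close> assemble them into the \<open>q\<close>-th power of the evaluation.
  Varying \<beta> then detects whether \<open>u\<close> vanishes at the point.\<close>

lemma herm_product_trace_word_right:
  assumes u: "u \<in> words q n"
  shows "(\<Sum>i<n. \<Sum>j<n. u i j ^ q * trace_word \<beta> (q * x) (q * y) i j) =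
         (\<Sum>l<m. (\<beta> * eval2 n u (\<alpha> ^ x) (\<alpha> ^ y) ^ q) ^ (q ^ (2 * l)))"
proof -
  have term_eq: "(\<beta> * (u i j * (\<alpha> ^ x) ^ i * (\<alpha> ^ y) ^ j) ^ q) ^ (q ^ (2 * l)) =
     u i j ^ q * (\<beta> * \<alpha> ^ (i * (q * x) + j * (q * y))) ^ (q ^ (2 * l))" for i j l
  proof -
    have "(\<beta> * (u i j * (\<alpha> ^ x) ^ i * (\<alpha> ^ y) ^ j) ^ q) =
      u i j ^ q * (\<beta> * \<alpha> ^ (i * (q * x) + j * (q * y)))"
      by (simp add: power_mult_distrib power_add algebra_simps flip: power_mult)
    moreover have "(u i j ^ q) ^ (q ^ (2 * l)) = u i j ^ q"
      using words_power[OF u, of i j l] by (metis mult.commute power_mult)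
    ultimately show ?thesis by (simp only: power_mult_distrib[of "u i j ^ q"])
  qed
  have "(\<Sum>l<m. (\<beta> * eval2 n u (\<alpha> ^ x) (\<alpha> ^ y) ^ q) ^ (q ^ (2 * l))) =
    (\<Sum>l<m. \<Sum>i<n. \<Sum>j<n. (\<beta> * (u i j * (\<alpha> ^ x) ^ i * (\<alpha> ^ y) ^ j) ^ q) ^ (q ^ (2 * l)))"
    by (simp only: eval2_def sum_power_q sum_power_q_power sum_distrib_left)
  also have "\<dots> = (\<Sum>i<n. \<Sum>l<m. \<Sum>j<n. u i j ^ q * (\<beta> * \<alpha> ^ (i * (q * x) + j * (q * y))) ^ (q ^ (2 * l)))"
    unfolding term_eq by (rule sum.swap)
  also have "\<dots> = (\<Sum>i<n. \<Sum>j<n. \<Sum>l<m. u i j ^ q * (\<beta> * \<alpha> ^ (i * (q * x) + j * (q * y))) ^ (q ^ (2 * l)))"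
    by (rule sum.cong[OF refl]) (rule sum.swap)
  also have "\<dots> = (\<Sum>i<n. \<Sum>j<n. u i j ^ q * trace_word \<beta> (q * x) (q * y) i j)"
    unfolding trace_word_def by (intro sum.cong refl) (simp add: sum_distrib_left)
  finally show ?thesis by simp
qed

lemma herm_product_trace_word_left:
  "(\<Sum>i<n. \<Sum>j<n. trace_word \<beta> s t i j ^ q * c i j) =
   (\<Sum>l<m. (\<beta> ^ (q ^ (2 * l))) ^ q *
      eval2 n c (\<alpha> ^ (q * s * q ^ (2 * l))) (\<alpha> ^ (q * t * q ^ (2 * l))))"
proof -
  let ?T = "\<lambda>i j l. (\<beta> ^ (q ^ (2 * l))) ^ q *
    (c i j * (\<alpha> ^ (q * s * q ^ (2 * l))) ^ i * (\<alpha> ^ (q * t * q ^ (2 * l))) ^ j)"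
  have "(\<Sum>i<n. \<Sum>j<n. trace_word \<beta> s t i j ^ q * c i j) = (\<Sum>i<n. \<Sum>j<n. \<Sum>l<m. ?T i j l)"
    unfolding trace_word_def
    by (intro sum.cong refl)
       (simp add: sum_power_q sum_distrib_left sum_distrib_right power_mult_distrib power_add algebra_simps
         flip: power_mult)
  also have "\<dots> = (\<Sum>i<n. \<Sum>l<m. \<Sum>j<n. ?T i j l)"
    by (rule sum.cong[OF refl]) (rule sum.swap)
  also have "\<dots> = (\<Sum>l<m. \<Sum>i<n. \<Sum>j<n. ?T i j l)" by (rule sum.swap)
  finally show ?thesis by (simp only: eval2_def sum_distrib_left)
qed

text \<open>A conflict yields a trace word in the dual that does not vanish at
  \<open>(x, y)\<close>. Without conflicts, the trace words with frequencies \<open>q * x\<close>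
  and \<open>q * y\<close> lie in the code, and orthogonality to them for every \<beta> forces a
  dual word to vanish at \<open>(x, y)\<close>.\<close>

lemma dual_containing_iff:
  "herm_dual q n (hyperbolic_code q n \<alpha> d) \<subseteq> hyperbolic_code q n \<alpha> d \<longleftrightarrow>
   \<not> (\<exists>(x, y) \<in> defining_set q n d. \<exists>(x', y') \<in> defining_set q n d.
        n dvd q * x + x' \<and> n dvd q * y + y')" (is "?D \<subseteq> ?C \<longleftrightarrow> \<not> ?conflict")
proof
  assume sub: "?D \<subseteq> ?C"
  show "\<not> ?conflict"
  proof
    assume ?conflict
    then obtain x y x' y' where Z: "(x, y) \<in> defining_set q n d" "(x', y') \<in> defining_set q n d"
      and dv: "n dvd q * x + x'" "n dvd q * y + y'" by blast
    have xy: "x < n" "y < n" using defining_set_less[OF Z(1) n_pos] .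
    \<comment> \<open>The conjugates that survive at \<open>(x, y)\<close>. There are several when
      the coset of the point has fewer than \<open>m\<close> elements, so \<beta> must be chosen to
      prevent cancellation.\<close>
    define S where
      "S = {l. l < m \<and> n dvd (n - x) * q ^ (2 * l) + x \<and> n dvd (n - y) * q ^ (2 * l) + y}"
    have "S \<subseteq> {..<m}" "0 \<in> S" using xy m_pos by (auto simp: S_def)
    then obtain \<beta> :: 'b where \<beta>: "(\<Sum>l\<in>S. \<beta> ^ (q ^ (2 * l))) \<noteq> 0"
      using linearized_nonzero by blast
    let ?u = "trace_word \<beta> (n - x) (n - y)"
    have "eval2 n ?u (\<alpha> ^ x) (\<alpha> ^ y) \<noteq> 0"
      using \<beta> by (simp add: eval2_trace_word S_def)
    then have "?u \<notin> ?C" using Z(1) by (auto simp: hyperbolic_code_def)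
    moreover have "?u \<in> ?D"
    proof -
      \<comment> \<open>Modulo \<open>n\<close>, \<open>q * (n - z)\<close> is the negative of
        \<open>q * z\<close>, that is \<open>z'\<close>; so \<open>c\<close> gets evaluated on the
        coset of \<open>(x', y')\<close>.\<close>
      have neg: "\<alpha> ^ (q * (n - z) * k) = \<alpha> ^ ((z' * k) mod n)" if "n dvd q * z + z'" "z < n" for z z' k
      proof -
        from that(1) obtain t where t: "q * z + z' = n * t" by (auto simp: dvd_def)
        have "q * (n - z) + (q * z + z') = q * n + z'"
          using that(2) by (simp add: algebra_simps flip: add_mult_distrib2)
        then have "(q * (n - z) + n * t) mod n = (q * n + z') mod n" by (simp only: t)
        then have "[q * (n - z) = z'] (mod n)" by (simp add: cong_def)
        then have "[q * (n - z) * k = z' * k] (mod n)" by (intro cong_mult cong_refl)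
        then show ?thesis by (metis cong_def power_mod_n)
      qed
      have "(\<Sum>i<n. \<Sum>j<n. ?u i j ^ q * c i j) = 0" if "c \<in> ?C" for c
      proof -
        have "eval2 n c (\<alpha> ^ (q * (n - x) * q ^ (2 * l))) (\<alpha> ^ (q * (n - y) * q ^ (2 * l))) = 0" for l
          unfolding neg[OF dv(1) xy(1)] neg[OF dv(2) xy(2)]
          using that defining_set_mult[OF Z(2), of l] by (auto simp: hyperbolic_code_def)
        then show ?thesis by (simp add: herm_product_trace_word_left)
      qed
      then show ?thesis using trace_word_in_words by (simp add: herm_dual_def)
    qed
    ultimately show False using sub by blast
  qed
next
  assume none: "\<not> ?conflict"
  show "?D \<subseteq> ?C"
  proof
    fix u assume u: "u \<in> ?D"
    then have uw: "u \<in> words q n" by (simp add: herm_dual_def)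
    have "eval2 n u (\<alpha> ^ x) (\<alpha> ^ y) = 0" if Z: "(x, y) \<in> defining_set q n d" for x y
    proof (rule ccontr)
      define w where "w = eval2 n u (\<alpha> ^ x) (\<alpha> ^ y)"
      assume "eval2 n u (\<alpha> ^ x) (\<alpha> ^ y) \<noteq> 0"
      then have w: "w \<noteq> 0" by (simp add: w_def)
      have "trace_word \<beta> (q * x) (q * y) \<in> ?C" for \<beta>
      proof -
        have "eval2 n (trace_word \<beta> (q * x) (q * y)) (\<alpha> ^ x') (\<alpha> ^ y') = 0"
          if Z': "(x', y') \<in> defining_set q n d" for x' y'
        proof -
          \<comment> \<open>A surviving conjugate would be a conflict of \<open>(x', y')\<close>
            with the shift of \<open>(x, y)\<close> by \<open>q ^ (2 * l)\<close>.\<close>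
          have "\<not> (n dvd q * x * q ^ (2 * l) + x' \<and> n dvd q * y * q ^ (2 * l) + y')" for l
          proof
            assume "n dvd q * x * q ^ (2 * l) + x' \<and> n dvd q * y * q ^ (2 * l) + y'"
            then have "n dvd q * ((x * q ^ (2 * l)) mod n) + x'"
              "n dvd q * ((y * q ^ (2 * l)) mod n) + y'"
              using dvd_mult_mod_add_mod[of n q _ x'] dvd_mult_mod_add_mod[of n q _ y']
                defining_set_less[OF Z' n_pos] by (simp_all add: mult.assoc)
            then show False using none Z' defining_set_mult[OF Z, of l] by blast
          qed
          then show ?thesis unfolding eval2_trace_word by (intro sum.neutral) blast
        qed
        then show ?thesis using trace_word_in_words by (auto simp: hyperbolic_code_def)
      qed
      then have zero: "(\<Sum>l<m. (\<beta> * w ^ q) ^ (q ^ (2 * l))) = 0" for \<beta>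
        using u herm_product_trace_word_right[OF uw, of \<beta> x y] by (auto simp: herm_dual_def w_def)
      obtain z :: 'b where z: "(\<Sum>l<m. z ^ (q ^ (2 * l))) \<noteq> 0"
        using linearized_nonzero[of "{..<m}"] m_pos by auto
      show False using zero[of "z / w ^ q"] z w by simp
    qed
    then show "u \<in> ?C" using uw by (auto simp: hyperbolic_code_def)
  qed
qed

end

subsection \<open>The optimal design distance\<close>

text \<open>The case \<open>e = m\<close> occurs only for odd \<open>m\<close>; there
  \<open>x * x'\<close> and \<open>y * y'\<close> are both at least \<open>delta_h q m\<close>, and
  regrouping the product of all four gives the claim. For \<open>e < m\<close> the bound
  \<open>n - q ^ e\<close> is at least \<open>delta_h q m\<close>.\<close>

lemma delta_h_le_small_exponent:
  fixes q m n e x y x' y' :: nat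
  assumes q: "2 \<le> q" and m: "0 < m" and n: "n = q ^ (2 * m) - 1" and e: "odd e" "e \<le> m"
    and x: "x \<in> {1..n}" "x' \<in> {1..n}" "n dvd q ^ e * x + x'"
    and y: "y \<in> {1..n}" "y' \<in> {1..n}" "n dvd q ^ e * y + y'"
  shows "delta_h q m \<le> x * y \<or> delta_h q m \<le> x' * y'"
proof -
  define A B where "A = q ^ e" and "B = q ^ (2 * m - e)"
  have pos: "1 < q ^ (2 * m)" using q m by (intro one_less_power) auto
  have AB: "A * B = n + 1" using e pos by (simp add: A_def B_def n flip: power_add)
  have A2: "2 \<le> A"
    using q self_le_power[of q e] odd_pos[OF e(1)] by (simp add: A_def)
  have AleQ: "A \<le> q ^ m" using q e by (simp add: A_def power_increasing)
  have QQ: "q ^ m * q ^ m = n + 1" using pos by (simp add: n flip: power_add mult_2)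
  have X: "0 < int x" "int x \<le> int n" "0 < int x'" "int x' \<le> int n" "int n dvd int A * int x + int x'"
    and Y: "0 < int y" "int y \<le> int n" "0 < int y'" "int y' \<le> int n" "int n dvd int A * int y + int y'"
    using x y by (auto simp flip: A_def of_nat_mult of_nat_add)
  have ABi: "int A * int B = int n + 1" using AB by (simp flip: of_nat_mult)
  show ?thesis
  proof (cases "e = m")
    case True
    then have A: "A = q ^ m" "B = q ^ m" by (simp_all add: A_def B_def)
    have d: "delta_h q m = (q ^ m - 1) * (q ^ m - 1)"
      using True e by (simp add: delta_h_def power2_eq_square)
    have di: "int (delta_h q m) = (int A - 1) * (int B - 1)"
      using A2 unfolding d A by (simp add: of_nat_diff)
    have A2i: "2 \<le> int A" "2 \<le> int B" using A2 unfolding A by linarith+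
    have "int (delta_h q m) \<le> int x * int x'" "int (delta_h q m) \<le> int y * int y'"
      unfolding di using neg_mult_product_bound[OF ABi A2i] X Y by blast+
    then have "delta_h q m \<le> x * x'" "delta_h q m \<le> y * y'" by (simp_all flip: of_nat_mult)
    then have ge: "delta_h q m * delta_h q m \<le> (x * x') * (y * y')" by (intro mult_mono) auto
    show ?thesis
    proof (rule ccontr)
      assume "\<not> ?thesis"
      then have "(x * y) * (x' * y') < delta_h q m * delta_h q m"
        by (intro mult_strict_mono) auto
      then show False using ge by (simp add: algebra_simps)
    qed
  next
    case False
    then have "e < m" using e by simp
    have "4 * A \<le> q ^ (2 * (m - e)) * A"
    proof (intro mult_right_mono)
      have "(4 :: nat) = 2 ^ 2" by simp
      also have "\<dots> \<le> q ^ 2" using q by (intro power_mono) auto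
      also have "\<dots> \<le> q ^ (2 * (m - e))" using q \<open>e < m\<close> by (intro power_increasing) auto
      finally show "4 \<le> q ^ (2 * (m - e))" .
    qed simp
    also have "\<dots> = q ^ (2 * (m - e) + e)" by (simp add: A_def power_add)
    also have "2 * (m - e) + e = 2 * m - e" using \<open>e < m\<close> by simp
    also have "q ^ (2 * m - e) = B" by (simp add: B_def)
    finally have "4 * A \<le> B" .
    then have "int n - int A \<le> int x * int y \<or> int n - int A \<le> int x' * int y'"
      using A2 by (intro neg_mult_pair_bound[OF ABi _ _ X Y]) auto
    then have "n - A \<le> x * y \<or> n - A \<le> x' * y'" by (simp flip: of_nat_mult) linarith
    \<comment> \<open>For odd \<open>m\<close>, \<open>(q ^ m - 1)^2\<close> is
      \<open>n + 2 - 2 * q ^ m\<close>, at most \<open>n - q ^ m\<close>. For even \<open>m\<close>,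
      the extreme exponent is \<open>m - 1\<close>.\<close>
    moreover have "delta_h q m \<le> n - A"
    proof (cases "odd m")
      case True
      have "int (delta_h q m) = (int (q ^ m) - 1) * (int (q ^ m) - 1)"
        using True A2 AleQ by (simp add: delta_h_def power2_eq_square of_nat_diff)
      also have "\<dots> = int (q ^ m * q ^ m) - 2 * int (q ^ m) + 1" by (simp add: algebra_simps)
      finally show ?thesis using AleQ A2 QQ by linarith
    next
      case False
      have "A \<le> q ^ (m - 1)" unfolding A_def using q \<open>e < m\<close> by (intro power_increasing) auto
      then show ?thesis using False by (simp add: delta_h_def n)
    qed
    ultimately show ?thesis by linarith
  qed
qed

lemma conflict_iff_delta_h_less:
  fixes q m n d :: nat
  assumes q: "2 \<le> q" and m: "0 < m" and n: "n = q ^ (2 * m) - 1"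
  shows "(\<exists>e x y x' y'. odd e \<and> e < 2 * m \<and> x \<in> {1..n} \<and> y \<in> {1..n} \<and> x' \<in> {1..n} \<and> y' \<in> {1..n} \<and>
            x * y < d \<and> x' * y' < d \<and> n dvd q ^ e * x + x' \<and> n dvd q ^ e * y + y') \<longleftrightarrow>
         delta_h q m < d" (is "?L \<longleftrightarrow> _")
proof
  assume ?L
  then obtain e x y x' y' where e: "odd e" "e < 2 * m"
    and x: "x \<in> {1..n}" "y \<in> {1..n}" "x' \<in> {1..n}" "y' \<in> {1..n}" "x * y < d" "x' * y' < d"
    and dv: "n dvd q ^ e * x + x'" "n dvd q ^ e * y + y'" by blast
  show "delta_h q m < d"
  proof (cases "e \<le> m")
    case True
    then show ?thesis using delta_h_le_small_exponent[OF q m n e(1) True] x dv by fastforce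
  next
    case False
    \<comment> \<open>Modulo \<open>n\<close>, \<open>q ^ (2 * m - e)\<close> is the inverse of
      \<open>q ^ e\<close>, and its exponent is odd as well.\<close>
    have swap: "n dvd q ^ (2 * m - e) * z' + z" if "n dvd q ^ e * z + z'" for z z'
    proof -
      have "n dvd q ^ (2 * m - e) * (q ^ e * z + z')" using that by simp
      also have "\<dots> = q ^ (2 * m - e + e) * z + q ^ (2 * m - e) * z'"
        by (simp add: power_add algebra_simps)
      also have "2 * m - e + e = 2 * m * 1 + 0" using e by simp
      finally have "n dvd q ^ 0 * z + q ^ (2 * m - e) * z'"
        using dvd_power_mult_add_cong[OF power_period_cong[OF n]] q by (metis neq0_conv not_numeral_le_zero)
      then show ?thesis by (simp add: add.commute)
    qed
    have "odd (2 * m - e)" "2 * m - e \<le> m" using e False by auto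
    from delta_h_le_small_exponent[OF q m n this, of x' x y' y] swap dv x
    show ?thesis by fastforce
  qed
next
  assume d: "delta_h q m < d"
  have pos: "1 < q ^ (2 * m)" using q m by (intro one_less_power) auto
  show ?L
  proof (cases "odd m")
    case True
    \<comment> \<open>With \<open>e = m\<close>, all four residues can be \<open>z\<close>, since
      \<open>(q ^ m + 1) * (q ^ m - 1) = n\<close>.\<close>
    define z where "z = q ^ m - 1"
    have Q: "q ^ m = z + 1" using q by (simp add: z_def)
    have "1 < q ^ m" using q m by (intro one_less_power) auto
    then have "1 \<le> z" by (simp add: z_def)
    have nz: "n = z * z + 2 * z" using n Q by (simp add: power_mult power2_eq_square mult.commute[of 2 m])
    then have "z \<in> {1..n}" using \<open>1 \<le> z\<close> by simp
    moreover have "z * z < d" using d True by (simp add: delta_h_def z_def power2_eq_square)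
    moreover have "q ^ m * z + z = n" by (simp add: Q nz)
    ultimately show ?thesis using True m
      by (intro exI[of _ m] exI[of _ z]) simp
  next
    case False
    \<comment> \<open>For even \<open>m\<close> the exponent \<open>m - 1\<close> is odd. The
      conflict is between \<open>(1, n - B)\<close> and \<open>(n - A, 1)\<close>; the larger
      product \<open>n - A\<close> is \<open>delta_h q m\<close>.\<close>
    define A B where "A = q ^ (m - 1)" and "B = q ^ (m + 1)"
    have "2 \<le> m" using False m by (auto elim: evenE)
    have "m - 1 + (m + 1) = 2 * m" using m by simp
    then have AB: "A * B = n + 1"
      unfolding A_def B_def power_add[symmetric] using pos by (simp only: n)
    have "A < B" unfolding A_def B_def using q by (intro power_strict_increasing) auto
    have "2 \<le> A" using q \<open>2 \<le> m\<close> self_le_power[of q "m - 1"] by (simp add: A_def)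
    then have "2 * B \<le> n + 1" using AB mult_right_mono[of 2 A B] by simp
    then have B: "B < n" using \<open>A < B\<close> \<open>2 \<le> A\<close> by simp
    have dA: "n - A < d" using d False by (simp add: delta_h_def n A_def)
    have 1: "n dvd A * 1 + (n - A)" using B \<open>A < B\<close> by simp
    have "A * (n - B) + A * B = A * n" using B by (simp flip: add_mult_distrib2)
    then have "A * (n - B) + 1 + n = A * n" using AB by simp
    then have 2: "n dvd A * (n - B) + 1"
      by (metis dvd_add_triv_right_iff dvd_triv_right)
    show ?thesis
    proof (intro exI conjI)
      show "odd (m - 1)" "m - 1 < 2 * m" using False m by auto
      show "1 \<in> {1..n}" "n - B \<in> {1..n}" "n - A \<in> {1..n}" "1 \<in> {1..n}"
        using B \<open>A < B\<close> by auto
      show "1 * (n - B) < d" "(n - A) * 1 < d" using dA \<open>A < B\<close> by auto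
      show "n dvd q ^ (m - 1) * 1 + (n - A)" "n dvd q ^ (m - 1) * (n - B) + 1"
        using 1 2 by (simp_all add: A_def)
    qed
  qed
qed

theorem theorem10:
  fixes q m n d :: nat and \<alpha> :: "'b::{finite,field}"
  assumes "prime_power q"
    and "card (UNIV :: 'b set) = q ^ (2 * m)"
    and "m > 3"
    and "n = q ^ (2 * m) - 1"
    and "primitive_root n \<alpha>"
    and "d \<ge> 2"
  shows "herm_dual q n (hyperbolic_code q n \<alpha> d) \<subseteq> hyperbolic_code q n \<alpha> d
         \<longleftrightarrow> d \<le> delta_h q m"
proof -
  have m: "0 < m" using assms by simp
  interpret bicyclic q m n \<alpha> using assms m by unfold_locales auto
  have "0 < q" using q_ge_2 by simp
  then show ?thesis
    unfolding dual_containing_iff defining_set_conflict_iff[OF \<open>0 < q\<close> m n_eq]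
      conflict_iff_delta_h_less[OF q_ge_2 m n_eq] by (simp add: not_less)
qed

end
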